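(* The set $\mathfrak B$ of badly approximable numbers is the unique maximal antiprime set in $\mathbb R$ (maximal with respect to inclusion among antiprime subsets of $\mathbb R$).
   Context: Fix a nonprincipal ultrafilter $\mathfrak u$ on $\mathbb N$, and let ${}^*\mathbb Z\subset{}^*\mathbb R$ be the ultrapowers of $\mathbb Z\subset\mathbb R$. Let ${}^*\mathbb R_{\rm fin}$ be the ring of bounded elements, ${}^*\mathbb R_\varepsilon$ its ideal of infinitesimals, and $({}^*\mathbb R_{\rm fin})^\times_+$ the multiplicative group of positive elements that are neither infinite nor infinitesimal. Let $\mathbb P:=({}^*\mathbb R_{>0}\cup\{0\})/({}^*\mathbb R_{\rm fin})^\times_+$; write $\langle x\rangle\in\mathbb P$ for the class of $|x|$, and $-\infty:=\langle0\rangle$. $\mathbb P$ has the induced product and total order ($\mu<\mu'$ iff $x<x'$ for all representatives; $-\infty$ is the minimum). $\mathbb P_\varepsilon\subset\mathbb P$ is the set of classes of positive infinitesimals. For $0\ne n\in{}^*\mathbb Z$ the growth is $\mu(n):=\langle n\rangle^{-1}$. For $\theta\in\mathbb R$, ${}^*\mathbb Z(\theta)$ is the group of $n\in{}^*\mathbb Z$ for which there is a (unique) $n^\perp\in{}^*\mathbb Z$ with $\varepsilon(n):=n\theta-n^\perp\in{}^*\mathbb R_\varepsilon$; the decay of $n\in{}^*\mathbb Z(\theta)$ is $\nu(n):=\langle\varepsilon(n)\rangle$. For $\mu,\nu\in\mathbb P_\varepsilon$, ${}^*\mathbb Z^\mu_\nu(\theta):=\{0\neq n\in{}^*\mathbb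 Z(\theta):\mu(n)>\mu,\ \nu(n)\le\nu\}\cup\{0\}$. For $\mu\ge\nu$ in $\mathbb P_\varepsilon$, say $\theta$ is $(\mu,\nu)$-composable with $\eta$ if ${}^*\mathbb Z^\mu_\nu(\theta)\neq0$ and ${}^*\mathbb Z^\nu_\mu(\eta)\ne0$. Let $\omega=\theta\eta$. $\theta$ is a fast divisor of $\omega$ if $\theta$ is $(\mu,\nu)$-composable with $\eta$ for some $\mu>\nu$; a slow divisor if $\eta$ is $(\mu,\nu)$-composable with $\theta$ for some $\mu>\nu$; a flat divisor if $\theta$ is $(\mu,\mu)$-composable with $\eta$ for some $\mu$. $\theta$ is an antidivisor of $\omega=\theta\eta$ if it is neither a fast, nor a slow, nor a flat divisor (with respect to this factorization). A set $X\subset\mathbb R$ is an antiprime set if for all $\theta_1,\theta_2\in X$ both $\theta_1$ and $\theta_2$ are antidivisors of $\theta_1\theta_2$ (with respect to the factorization $\theta_1\cdot\theta_2$); that is, for no $\theta_1,\theta_2\in X$ and no $\mu\ge\nu$ in $\mathbb P_\varepsilon$ is $\theta_1$ $(\mu,\nu)$-composable with $\theta_2$. $\mathfrak B$ is the set of irrational $\theta$ with $\liminf_{n\to\infty}n\|n\theta\|>0$, $\|\cdot\|$ the distance to the nearest integer. *)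

theory Defs
  imports Complex_Main "HOL-Library.Extended_Real"
begin

text \<open>
  A filter on the naturals plays the role of the family of its large sets: a set \<open>A\<close> belongs to
  \<open>U\<close> iff \<open>eventually (\<lambda>k. k \<in> A) U\<close>.  An ultrafilter is principal iff some singleton belongs to it.
\<close>

definition ultrafilter :: "nat filter \<Rightarrow> bool" where
  "ultrafilter U \<longleftrightarrow>
     U \<noteq> bot \<and> (\<forall>P. eventually P U \<or> eventually (\<lambda>k. \<not> P k) U)"

definition nonprincipal :: "nat filter \<Rightarrow> bool" where
  "nonprincipal U \<longleftrightarrow> (\<forall>m. \<not> eventually (\<lambda>k. k = m) U)"

text \<open>
  The ultrapower depends on \<open>U\<close>, so it is a carrier set of equivalence classes rather than a type.
\<close>

type_synonym hyperreal = "(nat \<Rightarrow> real) set"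

definition ultra_rel :: "nat filter \<Rightarrow> ((nat \<Rightarrow> real) \<times> (nat \<Rightarrow> real)) set" where
  "ultra_rel U = {(x, y). eventually (\<lambda>k. x k = y k) U}"

definition hclass :: "nat filter \<Rightarrow> (nat \<Rightarrow> real) \<Rightarrow> hyperreal" where
  "hclass U x = ultra_rel U `` {x}"

definition hreals :: "nat filter \<Rightarrow> hyperreal set" where
  "hreals U = UNIV // ultra_rel U"

definition hints :: "nat filter \<Rightarrow> hyperreal set" where
  "hints U = {hclass U (\<lambda>k. real_of_int (z k)) | z. True}"

definition hconst :: "nat filter \<Rightarrow> real \<Rightarrow> hyperreal" where
  "hconst U r = hclass U (\<lambda>_. r)"

definition hmap :: "nat filter \<Rightarrow> (real \<Rightarrow> real) \<Rightarrow> hyperreal \<Rightarrow> hyperreal" where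
  "hmap U f X = (\<Union>x\<in>X. hclass U (\<lambda>k. f (x k)))"

definition hmap2 :: "nat filter \<Rightarrow> (real \<Rightarrow> real \<Rightarrow> real) \<Rightarrow> hyperreal \<Rightarrow> hyperreal \<Rightarrow> hyperreal" where
  "hmap2 U f X Y = (\<Union>x\<in>X. \<Union>y\<in>Y. hclass U (\<lambda>k. f (x k) (y k)))"

definition habs :: "nat filter \<Rightarrow> hyperreal \<Rightarrow> hyperreal" where
  "habs U = hmap U abs"

definition hinverse :: "nat filter \<Rightarrow> hyperreal \<Rightarrow> hyperreal" where
  "hinverse U = hmap U inverse"

definition hminus :: "nat filter \<Rightarrow> hyperreal \<Rightarrow> hyperreal \<Rightarrow> hyperreal" where
  "hminus U = hmap2 U (-)"

definition htimes :: "nat filter \<Rightarrow> hyperreal \<Rightarrow> hyperreal \<Rightarrow> hyperreal" where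
  "htimes U = hmap2 U (*)"

definition hless :: "nat filter \<Rightarrow> hyperreal \<Rightarrow> hyperreal \<Rightarrow> bool" where
  "hless U X Y \<longleftrightarrow> (\<exists>x\<in>X. \<exists>y\<in>Y. eventually (\<lambda>k. x k < y k) U)"

definition hle :: "nat filter \<Rightarrow> hyperreal \<Rightarrow> hyperreal \<Rightarrow> bool" where
  "hle U X Y \<longleftrightarrow> (\<exists>x\<in>X. \<exists>y\<in>Y. eventually (\<lambda>k. x k \<le> y k) U)"

definition hfinite :: "nat filter \<Rightarrow> hyperreal set" where
  "hfinite U = {X \<in> hreals U. \<exists>r. hle U (habs U X) (hconst U r)}"

definition hinfinitesimal :: "nat filter \<Rightarrow> hyperreal set" where
  "hinfinitesimal U = {X \<in> hreals U. \<forall>r>0. hless U (habs U X) (hconst U r)}"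

definition hfinite_units_pos :: "nat filter \<Rightarrow> hyperreal set" where
  "hfinite_units_pos U = {X \<in> hfinite U - hinfinitesimal U. hless U (hconst U 0) X}"

definition hnonneg :: "nat filter \<Rightarrow> hyperreal set" where
  "hnonneg U = {X \<in> hreals U. hless U (hconst U 0) X} \<union> {hconst U 0}"


type_synonym growth_class = "hyperreal set"

definition growth_rel :: "nat filter \<Rightarrow> (hyperreal \<times> hyperreal) set" where
  "growth_rel U = {(X, Y). X \<in> hnonneg U \<and> Y \<in> hnonneg U \<and>
                     (\<exists>C\<in>hfinite_units_pos U. Y = htimes U C X)}"

definition PP :: "nat filter \<Rightarrow> growth_class set" where
  "PP U = hnonneg U // growth_rel U"

definition gclass :: "nat filter \<Rightarrow> hyperreal \<Rightarrow> growth_class" where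
  "gclass U X = growth_rel U `` {habs U X}"

definition gless :: "nat filter \<Rightarrow> growth_class \<Rightarrow> growth_class \<Rightarrow> bool" where
  "gless U \<mu> \<mu>' \<longleftrightarrow> (\<forall>X\<in>\<mu>. \<forall>X'\<in>\<mu>'. hless U X X')"

definition gle :: "nat filter \<Rightarrow> growth_class \<Rightarrow> growth_class \<Rightarrow> bool" where
  "gle U \<mu> \<mu>' \<longleftrightarrow> gless U \<mu> \<mu>' \<or> \<mu> = \<mu>'"

text \<open>
  Inverse for the product induced on \<open>PP U\<close>, meaningful only away from the class of zero.
\<close>

definition ginverse :: "nat filter \<Rightarrow> growth_class \<Rightarrow> growth_class" where
  "ginverse U \<mu> = (\<Union>X\<in>\<mu>. gclass U (hinverse U X))"

definition PP_eps :: "nat filter \<Rightarrow> growth_class set" where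
  "PP_eps U = {\<mu> \<in> PP U. \<exists>X\<in>hinfinitesimal U. hless U (hconst U 0) X \<and> \<mu> = gclass U X}"


definition growth :: "nat filter \<Rightarrow> hyperreal \<Rightarrow> growth_class" where
  "growth U N = ginverse U (gclass U N)"

definition hints_approx :: "nat filter \<Rightarrow> real \<Rightarrow> hyperreal set" where
  "hints_approx U \<theta> =
     {N \<in> hints U. \<exists>M\<in>hints U. hminus U (htimes U N (hconst U \<theta>)) M \<in> hinfinitesimal U}"

definition perp :: "nat filter \<Rightarrow> real \<Rightarrow> hyperreal \<Rightarrow> hyperreal" where
  "perp U \<theta> N =
     (THE M. M \<in> hints U \<and> hminus U (htimes U N (hconst U \<theta>)) M \<in> hinfinitesimal U)"

definition approx_error :: "nat filter \<Rightarrow> real \<Rightarrow> hyperreal \<Rightarrow> hyperreal" where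
  "approx_error U \<theta> N = hminus U (htimes U N (hconst U \<theta>)) (perp U \<theta> N)"

definition decay :: "nat filter \<Rightarrow> real \<Rightarrow> hyperreal \<Rightarrow> growth_class" where
  "decay U \<theta> N = gclass U (approx_error U \<theta> N)"

definition hints_growth_decay ::
    "nat filter \<Rightarrow> growth_class \<Rightarrow> growth_class \<Rightarrow> real \<Rightarrow> hyperreal set" where
  "hints_growth_decay U \<mu> \<nu> \<theta> =
     {N \<in> hints_approx U \<theta>. N \<noteq> hconst U 0 \<and> gless U \<mu> (growth U N) \<and> gle U (decay U \<theta> N) \<nu>}
     \<union> {hconst U 0}"


definition composable ::
    "nat filter \<Rightarrow> growth_class \<Rightarrow> growth_class \<Rightarrow> real \<Rightarrow> real \<Rightarrow> bool" where
  "composable U \<mu> \<nu> \<theta> \<eta> \<longleftrightarrow>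
     \<mu> \<in> PP_eps U \<and> \<nu> \<in> PP_eps U \<and> gle U \<nu> \<mu> \<and>
     hints_growth_decay U \<mu> \<nu> \<theta> \<noteq> {hconst U 0} \<and>
     hints_growth_decay U \<nu> \<mu> \<eta> \<noteq> {hconst U 0}"

text \<open>
  The divisor notions refer to a factorization \<open>\<omega> = \<theta> * \<eta>\<close>, so the cofactor \<open>\<eta>\<close> is an argument.
\<close>

definition fast_divisor :: "nat filter \<Rightarrow> real \<Rightarrow> real \<Rightarrow> real \<Rightarrow> bool" where
  "fast_divisor U \<theta> \<eta> \<omega> \<longleftrightarrow>
     \<omega> = \<theta> * \<eta> \<and> (\<exists>\<mu> \<nu>. gless U \<nu> \<mu> \<and> composable U \<mu> \<nu> \<theta> \<eta>)"

definition slow_divisor :: "nat filter \<Rightarrow> real \<Rightarrow> real \<Rightarrow> real \<Rightarrow> bool" where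
  "slow_divisor U \<theta> \<eta> \<omega> \<longleftrightarrow>
     \<omega> = \<theta> * \<eta> \<and> (\<exists>\<mu> \<nu>. gless U \<nu> \<mu> \<and> composable U \<mu> \<nu> \<eta> \<theta>)"

definition flat_divisor :: "nat filter \<Rightarrow> real \<Rightarrow> real \<Rightarrow> real \<Rightarrow> bool" where
  "flat_divisor U \<theta> \<eta> \<omega> \<longleftrightarrow>
     \<omega> = \<theta> * \<eta> \<and> (\<exists>\<mu>. composable U \<mu> \<mu> \<theta> \<eta>)"

definition antidivisor :: "nat filter \<Rightarrow> real \<Rightarrow> real \<Rightarrow> real \<Rightarrow> bool" where
  "antidivisor U \<theta> \<eta> \<omega> \<longleftrightarrow>
     \<omega> = \<theta> * \<eta> \<and>
     \<not> fast_divisor U \<theta> \<eta> \<omega> \<and> \<not> slow_divisor U \<theta> \<eta> \<omega> \<and> \<not> flat_divisor U \<theta> \<eta> \<omega>"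

definition antiprime :: "nat filter \<Rightarrow> real set \<Rightarrow> bool" where
  "antiprime U X \<longleftrightarrow>
     (\<forall>\<theta>\<^sub>1\<in>X. \<forall>\<theta>\<^sub>2\<in>X. antidivisor U \<theta>\<^sub>1 \<theta>\<^sub>2 (\<theta>\<^sub>1 * \<theta>\<^sub>2) \<and> antidivisor U \<theta>\<^sub>2 \<theta>\<^sub>1 (\<theta>\<^sub>1 * \<theta>\<^sub>2))"

definition maximal_antiprime :: "nat filter \<Rightarrow> real set \<Rightarrow> bool" where
  "maximal_antiprime U X \<longleftrightarrow> antiprime U X \<and> (\<forall>Y. antiprime U Y \<and> X \<subseteq> Y \<longrightarrow> Y = X)"


definition dist_nearest_int :: "real \<Rightarrow> real" where
  "dist_nearest_int x = \<bar>x - of_int (round x)\<bar>"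

definition badly_approximable :: "real set" where
  "badly_approximable =
     {\<theta>. \<theta> \<notin> \<rat> \<and> liminf (\<lambda>n. ereal (real n * dist_nearest_int (real n * \<theta>))) > 0}"

end

theory Submission
  imports Defs
begin

text \<open>
  A real number \<open>\<theta>\<close> is badly approximable iff \<open>\<bar>n\<bar> * \<bar>n * \<theta> - m\<bar>\<close> is bounded below by some \<open>c > 0\<close>
  over all integers \<open>n \<noteq> 0\<close> and \<open>m\<close>.  In that case the decay of a nonzero \<open>n\<close> is at least its
  growth, so no \<open>\<mu> \<ge> \<nu>\<close> can satisfy \<open>\<mu> < \<mu>(n)\<close> and \<open>\<nu>(n) \<le> \<nu>\<close>; hence a badly approximable number is
  not composable with anything.  Otherwise pick \<open>n k \<noteq> 0\<close> with
  \<open>\<bar>n k\<bar> * \<bar>n k * \<theta> - m k\<bar> < 1 / (k + 1)\<^sup>2\<close>; the class of \<open>1 / ((k + 1) * \<bar>n k\<bar>)\<close> lies strictly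
  between the decay and the growth of \<open>n\<close>, which makes \<open>\<theta>\<close> a flat divisor of \<open>\<theta>\<^sup>2\<close>.  Therefore the antiprime
  sets are exactly the sets of badly approximable numbers.
\<close>

section \<open>The ultrapower in terms of sequences\<close>

lemma hclass_eq_Collect: "hclass U x = {y. eventually (\<lambda>k. x k = y k) U}"
  by (auto simp: hclass_def ultra_rel_def)

lemma hclass_eq_iff: "hclass U x = hclass U y \<longleftrightarrow> eventually (\<lambda>k. x k = y k) U"
proof
  assume "hclass U x = hclass U y"
  moreover have "y \<in> hclass U y" by (simp add: hclass_eq_Collect)
  ultimately show "eventually (\<lambda>k. x k = y k) U"
    by (metis hclass_eq_Collect mem_Collect_eq)
next
  assume xy: "eventually (\<lambda>k. x k = y k) U"
  have "eventually (\<lambda>k. x k = z k) U \<longleftrightarrow> eventually (\<lambda>k. y k = z k) U" for z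
    by (rule eventually_cong[OF xy]) simp
  then show "hclass U x = hclass U y" by (simp add: hclass_eq_Collect)
qed

lemma hclass_in_hreals: "hclass U x \<in> hreals U"
  by (auto simp: hreals_def hclass_def intro: quotientI)

lemma hrealsE:
  assumes "X \<in> hreals U"
  obtains x where "X = hclass U x"
  using assms that unfolding hreals_def hclass_def by (rule quotientE)

text \<open>Applying \<open>f\<close> termwise respects eventual equality, so all members of the
  union that defines \<open>hmap\<close> are the same class and the union collapses to it.\<close>

lemma hmap_hclass: "hmap U f (hclass U x) = hclass U (\<lambda>k. f (x k))"
proof -
  have "hclass U (\<lambda>k. f (y k)) = hclass U (\<lambda>k. f (x k))" if "y \<in> hclass U x" for y
    using that by (auto simp: hclass_eq_Collect[of U x] hclass_eq_iff elim: eventually_mono)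
  moreover have "x \<in> hclass U x" by (simp add: hclass_eq_Collect)
  ultimately show ?thesis unfolding hmap_def by blast
qed

lemma hmap2_hclass: "hmap2 U f (hclass U x) (hclass U y) = hclass U (\<lambda>k. f (x k) (y k))"
proof -
  have "hclass U (\<lambda>k. f (x' k) (y' k)) = hclass U (\<lambda>k. f (x k) (y k))"
    if "x' \<in> hclass U x" "y' \<in> hclass U y" for x' y'
  proof -
    have "eventually (\<lambda>k. x k = x' k) U" "eventually (\<lambda>k. y k = y' k) U"
      using that by (auto simp: hclass_eq_Collect)
    then show ?thesis unfolding hclass_eq_iff by eventually_elim simp
  qed
  moreover have "x \<in> hclass U x" "y \<in> hclass U y" by (simp_all add: hclass_eq_Collect)
  ultimately show ?thesis unfolding hmap2_def by blast
qed

lemma habs_hclass: "habs U (hclass U x) = hclass U (\<lambda>k. \<bar>x k\<bar>)"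
  by (simp add: habs_def hmap_hclass)

lemma hinverse_hclass: "hinverse U (hclass U x) = hclass U (\<lambda>k. inverse (x k))"
  by (simp add: hinverse_def hmap_hclass)

lemma hminus_hclass: "hminus U (hclass U x) (hclass U y) = hclass U (\<lambda>k. x k - y k)"
  by (simp add: hminus_def hmap2_hclass)

lemma htimes_hclass: "htimes U (hclass U x) (hclass U y) = hclass U (\<lambda>k. x k * y k)"
  by (simp add: htimes_def hmap2_hclass)

lemma hless_hclass: "hless U (hclass U x) (hclass U y) \<longleftrightarrow> eventually (\<lambda>k. x k < y k) U"
proof
  assume "hless U (hclass U x) (hclass U y)"
  then obtain x' y' where "eventually (\<lambda>k. x k = x' k) U" "eventually (\<lambda>k. y k = y' k) U"
      "eventually (\<lambda>k. x' k < y' k) U"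
    by (auto simp: hless_def hclass_eq_Collect)
  then show "eventually (\<lambda>k. x k < y k) U" by eventually_elim simp
next
  have "x \<in> hclass U x" "y \<in> hclass U y" by (simp_all add: hclass_eq_Collect)
  then show "eventually (\<lambda>k. x k < y k) U \<Longrightarrow> hless U (hclass U x) (hclass U y)"
    unfolding hless_def by blast
qed

lemma hle_hclass: "hle U (hclass U x) (hclass U y) \<longleftrightarrow> eventually (\<lambda>k. x k \<le> y k) U"
proof
  assume "hle U (hclass U x) (hclass U y)"
  then obtain x' y' where "eventually (\<lambda>k. x k = x' k) U" "eventually (\<lambda>k. y k = y' k) U"
      "eventually (\<lambda>k. x' k \<le> y' k) U"
    by (auto simp: hle_def hclass_eq_Collect)
  then show "eventually (\<lambda>k. x k \<le> y k) U" by eventually_elim simp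
next
  have "x \<in> hclass U x" "y \<in> hclass U y" by (simp_all add: hclass_eq_Collect)
  then show "eventually (\<lambda>k. x k \<le> y k) U \<Longrightarrow> hle U (hclass U x) (hclass U y)"
    unfolding hle_def by blast
qed

section \<open>Infinitesimals, bounded elements, positive units and nonnegative elements\<close>

lemma hclass_in_hinfinitesimal_iff:
  "hclass U x \<in> hinfinitesimal U \<longleftrightarrow> (\<forall>r>0. eventually (\<lambda>k. \<bar>x k\<bar> < r) U)"
  by (simp add: hinfinitesimal_def hclass_in_hreals habs_hclass hconst_def hless_hclass)

lemma hclass_in_hfinite_iff: "hclass U x \<in> hfinite U \<longleftrightarrow> (\<exists>r. eventually (\<lambda>k. \<bar>x k\<bar> \<le> r) U)"
  by (simp add: hfinite_def hclass_in_hreals habs_hclass hconst_def hle_hclass)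

text \<open>One direction is properness, the other maximality. This turns negated statements, such
  as being nonzero or not infinitesimal, into statements that hold eventually.\<close>

lemma ultrafilter_eventually_not_iff:
  assumes "ultrafilter U"
  shows "eventually (\<lambda>k. \<not> P k) U \<longleftrightarrow> \<not> eventually P U"
proof
  assume nP: "eventually (\<lambda>k. \<not> P k) U"
  show "\<not> eventually P U"
  proof
    assume "eventually P U"
    with nP have "eventually (\<lambda>k. False) U" by eventually_elim simp
    with assms show False by (simp add: ultrafilter_def)
  qed
qed (use assms in \<open>auto simp: ultrafilter_def\<close>)

text \<open>Failing to be infinitesimal only says that some bound \<open>\<bar>c k\<bar> < r\<close>
  does not hold eventually; maximality of \<open>U\<close> upgrades this to an eventual lower bound
  \<open>r\<close>.\<close>

lemma hclass_in_hfinite_units_pos_iff: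
  assumes "ultrafilter U"
  shows "hclass U c \<in> hfinite_units_pos U \<longleftrightarrow>
    (\<exists>a>0. \<exists>b. eventually (\<lambda>k. a \<le> c k \<and> c k \<le> b) U)" (is "?L \<longleftrightarrow> ?R")
proof
  assume ?L
  then obtain r b where r: "r > 0" "\<not> eventually (\<lambda>k. \<bar>c k\<bar> < r) U"
    and b: "eventually (\<lambda>k. \<bar>c k\<bar> \<le> b) U" and c: "eventually (\<lambda>k. 0 < c k) U"
    by (auto simp: hfinite_units_pos_def hclass_in_hfinite_iff hclass_in_hinfinitesimal_iff
        hconst_def hless_hclass)
  from r(2) have "eventually (\<lambda>k. \<not> \<bar>c k\<bar> < r) U"
    using assms by (simp add: ultrafilter_eventually_not_iff)
  with b c have "eventually (\<lambda>k. r \<le> c k \<and> c k \<le> b) U" by eventually_elim auto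
  with r(1) show ?R by blast
next
  assume ?R
  then obtain a b where a: "a > 0" and ab: "eventually (\<lambda>k. a \<le> c k \<and> c k \<le> b) U" by blast
  have "eventually (\<lambda>k. \<not> \<bar>c k\<bar> < a) U" using ab by eventually_elim auto
  then have "\<not> eventually (\<lambda>k. \<bar>c k\<bar> < a) U"
    using assms by (simp add: ultrafilter_eventually_not_iff)
  moreover have "eventually (\<lambda>k. \<bar>c k\<bar> \<le> b) U" using ab by eventually_elim (use a in auto)
  moreover have "eventually (\<lambda>k. 0 < c k) U" using ab by eventually_elim (use a in auto)
  ultimately show ?L using a
    by (auto simp: hfinite_units_pos_def hclass_in_hfinite_iff hclass_in_hinfinitesimal_iff
        hconst_def hless_hclass)
qed

lemma hclass_in_hnonneg_iff:
  assumes "ultrafilter U"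
  shows "hclass U x \<in> hnonneg U \<longleftrightarrow> eventually (\<lambda>k. 0 \<le> x k) U" (is "?L \<longleftrightarrow> ?R")
proof
  assume ?L
  then have "eventually (\<lambda>k. 0 < x k) U \<or> eventually (\<lambda>k. x k = 0) U"
    by (auto simp: hnonneg_def hconst_def hless_hclass hclass_eq_iff)
  then show ?R by (auto elim: eventually_mono)
next
  assume R: ?R
  \<comment> \<open>\<open>hnonneg\<close> separates zero from the positive elements, and only an
    ultrafilter decides which of the two cases occurs.\<close>
  have "eventually (\<lambda>k. x k = 0) U \<or> eventually (\<lambda>k. x k \<noteq> 0) U"
    using assms by (auto simp: ultrafilter_def)
  then show ?L
  proof
    assume "eventually (\<lambda>k. x k \<noteq> 0) U"
    with R have "eventually (\<lambda>k. 0 < x k) U" by eventually_elim auto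
    then show ?L by (simp add: hnonneg_def hconst_def hless_hclass hclass_in_hreals)
  qed (simp add: hnonneg_def hconst_def hclass_eq_iff)
qed

section \<open>Growth classes in terms of sequences\<close>

text \<open>Multiplying by a positive unit changes a sequence by a ratio bounded above and away from
  zero. A growth class is thus an order of magnitude, and the class of zero contains zero
  only.\<close>

lemma hclass_in_gclass_iff:
  assumes "ultrafilter U"
  shows "hclass U y \<in> gclass U (hclass U x) \<longleftrightarrow>
    (\<exists>a>0. \<exists>b. eventually (\<lambda>k. a * \<bar>x k\<bar> \<le> y k \<and> y k \<le> b * \<bar>x k\<bar>) U)" (is "?L \<longleftrightarrow> ?R")
proof
  assume ?L
  then obtain C where C: "C \<in> hfinite_units_pos U" "hclass U y = htimes U C (hclass U (\<lambda>k. \<bar>x k\<bar>))"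
    by (auto simp: gclass_def growth_rel_def habs_hclass)
  then obtain c where c: "C = hclass U c"
    by (auto simp: hfinite_units_pos_def hfinite_def elim: hrealsE)
  with C(2) have y: "eventually (\<lambda>k. y k = c k * \<bar>x k\<bar>) U"
    by (simp add: htimes_hclass hclass_eq_iff)
  from C(1) c obtain a b where "a > 0" and ab: "eventually (\<lambda>k. a \<le> c k \<and> c k \<le> b) U"
    using assms by (auto simp: hclass_in_hfinite_units_pos_iff)
  from ab y have "eventually (\<lambda>k. a * \<bar>x k\<bar> \<le> y k \<and> y k \<le> b * \<bar>x k\<bar>) U"
    by eventually_elim (simp add: mult_right_mono)
  with \<open>a > 0\<close> show ?R by blast
next
  assume ?R
  then obtain a b where a: "a > 0"
    and ab: "eventually (\<lambda>k. a * \<bar>x k\<bar> \<le> y k \<and> y k \<le> b * \<bar>x k\<bar>) U" by blast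
  \<comment> \<open>The unit is the termwise ratio. Where \<open>x k = 0\<close> the bounds force
    \<open>y k = 0\<close>, so any value serves; \<open>a\<close> keeps the lower bound, and
    \<open>max a b\<close> below allows for \<open>b < a\<close> at such indices.\<close>
  define c where "c k = (if x k = 0 then a else y k / \<bar>x k\<bar>)" for k
  have "eventually (\<lambda>k. a \<le> c k \<and> c k \<le> max a b) U"
    using ab by eventually_elim (auto simp: c_def field_simps le_max_iff_disj)
  then have "hclass U c \<in> hfinite_units_pos U"
    using a assms by (auto simp: hclass_in_hfinite_units_pos_iff)
  moreover have "eventually (\<lambda>k. y k = c k * \<bar>x k\<bar>) U"
    using ab by eventually_elim (auto simp: c_def)
  then have "hclass U y = htimes U (hclass U c) (hclass U (\<lambda>k. \<bar>x k\<bar>))"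
    by (simp add: htimes_hclass hclass_eq_iff)
  moreover have "eventually (\<lambda>k. 0 \<le> y k) U"
    using ab by eventually_elim (meson a abs_ge_zero less_imp_le mult_nonneg_nonneg order_trans)
  then have "hclass U y \<in> hnonneg U" using assms by (simp add: hclass_in_hnonneg_iff)
  moreover have "hclass U (\<lambda>k. \<bar>x k\<bar>) \<in> hnonneg U" using assms by (simp add: hclass_in_hnonneg_iff)
  ultimately show ?L by (auto simp: gclass_def growth_rel_def habs_hclass)
qed

lemma gclass_elemE:
  assumes "X \<in> gclass U (hclass U x)"
  obtains y where "X = hclass U y"
proof -
  from assms have "X \<in> hreals U"
    by (auto simp: gclass_def growth_rel_def hnonneg_def hconst_def hclass_in_hreals)
  then show ?thesis using that by (rule hrealsE)
qed

lemma abs_in_gclass: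
  assumes "ultrafilter U"
  shows "hclass U (\<lambda>k. \<bar>x k\<bar>) \<in> gclass U (hclass U x)"
  unfolding hclass_in_gclass_iff[OF assms] by (intro exI[of _ 1] conjI) auto

lemma gclass_subsetI:
  assumes "ultrafilter U" "a > 0" "b > 0"
    and "eventually (\<lambda>k. a * \<bar>x k\<bar> \<le> \<bar>y k\<bar> \<and> \<bar>y k\<bar> \<le> b * \<bar>x k\<bar>) U"
  shows "gclass U (hclass U y) \<subseteq> gclass U (hclass U x)"
proof
  fix Z assume Z: "Z \<in> gclass U (hclass U y)"
  then obtain z where z: "Z = hclass U z" by (rule gclass_elemE)
  with Z obtain c d where c: "c > 0"
    and cd: "eventually (\<lambda>k. c * \<bar>y k\<bar> \<le> z k \<and> z k \<le> d * \<bar>y k\<bar>) U"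
    using assms by (auto simp: hclass_in_gclass_iff)
  \<comment> \<open>The sign of \<open>d\<close> is unknown, and a negative factor would reverse the
    upper bound on \<open>\<bar>y k\<bar>\<close>; hence \<open>max 0 d\<close>.\<close>
  from assms(4) cd have "eventually (\<lambda>k. c * a * \<bar>x k\<bar> \<le> z k \<and> z k \<le> max 0 d * b * \<bar>x k\<bar>) U"
  proof eventually_elim
    case (elim k)
    have "c * (a * \<bar>x k\<bar>) \<le> c * \<bar>y k\<bar>" using elim c by (intro mult_left_mono) auto
    moreover have "max 0 d * \<bar>y k\<bar> \<le> max 0 d * (b * \<bar>x k\<bar>)"
      using elim by (intro mult_left_mono) auto
    moreover have "d * \<bar>y k\<bar> \<le> max 0 d * \<bar>y k\<bar>" by (intro mult_right_mono) auto
    ultimately show ?case using elim by (simp add: mult.assoc)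
  qed
  then show "Z \<in> gclass U (hclass U x)"
    using c assms(2) unfolding z hclass_in_gclass_iff[OF assms(1)]
    by (intro exI[of _ "c * a"] conjI exI[of _ "max 0 d * b"]) auto
qed

lemma gclass_eqI:
  assumes "ultrafilter U" "a > 0" "b > 0"
    and ev: "eventually (\<lambda>k. a * \<bar>x k\<bar> \<le> \<bar>y k\<bar> \<and> \<bar>y k\<bar> \<le> b * \<bar>x k\<bar>) U"
  shows "gclass U (hclass U y) = gclass U (hclass U x)"
proof
  show "gclass U (hclass U y) \<subseteq> gclass U (hclass U x)" by (rule gclass_subsetI[OF assms])
  \<comment> \<open>Comparability is symmetric: the two constants trade places and are
    inverted.\<close>
  have "eventually (\<lambda>k. inverse b * \<bar>y k\<bar> \<le> \<bar>x k\<bar> \<and> \<bar>x k\<bar> \<le> inverse a * \<bar>y k\<bar>) U"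
    using ev by eventually_elim (use assms in \<open>auto simp: field_simps\<close>)
  then show "gclass U (hclass U x) \<subseteq> gclass U (hclass U y)"
    using assms by (intro gclass_subsetI[of U "inverse b" "inverse a"]) auto
qed

text \<open>Inversion turns bounds on a ratio into bounds on the inverse ratio, so the class does
  not depend on the representative. At a zero of \<open>x\<close> the representative vanishes too,
  and the convention \<open>inverse 0 = 0\<close> makes the estimate trivial.\<close>

lemma ginverse_gclass:
  assumes U: "ultrafilter U"
  shows "ginverse U (gclass U (hclass U x)) = gclass U (hclass U (\<lambda>k. inverse (x k)))"
proof -
  have eq: "gclass U (hinverse U Y) = gclass U (hclass U (\<lambda>k. inverse (x k)))"
    if Y: "Y \<in> gclass U (hclass U x)" for Y
  proof -
    obtain y where y: "Y = hclass U y" using Y by (rule gclass_elemE)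
    with Y obtain a b where a: "a > 0"
      and ab: "eventually (\<lambda>k. a * \<bar>x k\<bar> \<le> y k \<and> y k \<le> b * \<bar>x k\<bar>) U"
      using U by (auto simp: hclass_in_gclass_iff)
    define c where "c = max a b"
    have c: "c > 0" "b \<le> c" using a by (auto simp: c_def)
    have "eventually (\<lambda>k. inverse c * \<bar>inverse (x k)\<bar> \<le> \<bar>inverse (y k)\<bar> \<and>
        \<bar>inverse (y k)\<bar> \<le> inverse a * \<bar>inverse (x k)\<bar>) U"
      using ab
    proof eventually_elim
      case (elim k)
      show ?case
      proof (cases "x k = 0")
        case False
        then have "0 < a * \<bar>x k\<bar>" using a by simp
        moreover have "b * \<bar>x k\<bar> \<le> c * \<bar>x k\<bar>" using c by (intro mult_right_mono) auto
        ultimately have "0 < a * \<bar>x k\<bar>" "a * \<bar>x k\<bar> \<le> \<bar>y k\<bar>" "0 < \<bar>y k\<bar>" "\<bar>y k\<bar> \<le> c * \<bar>x k\<bar>"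
          using elim by auto
        then have "inverse (c * \<bar>x k\<bar>) \<le> inverse \<bar>y k\<bar>" "inverse \<bar>y k\<bar> \<le> inverse (a * \<bar>x k\<bar>)"
          using le_imp_inverse_le by blast+
        then show ?thesis by (simp add: abs_inverse)
      qed (use elim in auto)
    qed
    then show ?thesis unfolding y hinverse_hclass
      by (rule gclass_eqI[OF U, rotated 2]) (use a c in auto)
  qed
  \<comment> \<open>An empty class would make the union in \<open>ginverse\<close> empty.\<close>
  moreover have "gclass U (hclass U x) \<noteq> {}" using abs_in_gclass[OF U] by blast
  ultimately show ?thesis unfolding ginverse_def by blast
qed

lemma growth_hclass:
  assumes "ultrafilter U"
  shows "growth U (hclass U n) = gclass U (hclass U (\<lambda>k. inverse (n k)))"
  using assms by (simp add: growth_def ginverse_gclass)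

text \<open>Every positive multiple of a representative lies in the same class, which forces the
  inequality for each \<open>C\<close>. Conversely, the ratio bounds of arbitrary representatives
  are absorbed into a single \<open>C\<close>.\<close>

lemma gless_gclass_iff:
  assumes U: "ultrafilter U"
  shows "gless U (gclass U (hclass U x)) (gclass U (hclass U y)) \<longleftrightarrow>
    (\<forall>C>0. eventually (\<lambda>k. C * \<bar>x k\<bar> < \<bar>y k\<bar>) U)" (is "?L \<longleftrightarrow> ?R")
proof
  assume L: ?L
  show ?R
  proof (intro allI impI)
    fix C :: real assume C: "C > 0"
    then have "hclass U (\<lambda>k. C * \<bar>x k\<bar>) \<in> gclass U (hclass U x)"
      unfolding hclass_in_gclass_iff[OF U] by (intro exI[of _ C] conjI) auto
    with L abs_in_gclass[OF U] show "eventually (\<lambda>k. C * \<bar>x k\<bar> < \<bar>y k\<bar>) U"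
      unfolding gless_def by (metis hless_hclass)
  qed
next
  assume R: ?R
  show ?L unfolding gless_def
  proof (intro ballI)
    fix X Y assume X: "X \<in> gclass U (hclass U x)" and Y: "Y \<in> gclass U (hclass U y)"
    obtain x' where x': "X = hclass U x'" using X by (rule gclass_elemE)
    obtain y' where y': "Y = hclass U y'" using Y by (rule gclass_elemE)
    from X x' obtain b where b: "eventually (\<lambda>k. x' k \<le> b * \<bar>x k\<bar>) U"
      using U by (auto simp: hclass_in_gclass_iff eventually_conj_iff)
    from Y y' obtain a where a: "a > 0" "eventually (\<lambda>k. a * \<bar>y k\<bar> \<le> y' k) U"
      using U by (auto simp: hclass_in_gclass_iff eventually_conj_iff)
    \<comment> \<open>The factor \<open>b\<close> comes from the upper bound on \<open>x'\<close>,
      the division by \<open>a\<close> from the lower bound on \<open>y'\<close>; the maximum with 1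
      makes the constant positive.\<close>
    have "eventually (\<lambda>k. (max 1 b / a) * \<bar>x k\<bar> < \<bar>y k\<bar>) U"
      by (rule R[rule_format]) (use a in auto)
    with b a(2) have "eventually (\<lambda>k. x' k < y' k) U"
    proof eventually_elim
      case (elim k)
      have "b * \<bar>x k\<bar> \<le> max 1 b * \<bar>x k\<bar>" by (intro mult_right_mono) auto
      moreover have "max 1 b * \<bar>x k\<bar> < a * \<bar>y k\<bar>" using elim(3) a(1) by (simp add: field_simps)
      ultimately show ?case using elim by linarith
    qed
    then show "hless U X Y" by (simp add: x' y' hless_hclass)
  qed
qed

text \<open>A strict inequality gives the constant 1; equality of the classes gives the upper ratio
  bound, enlarged to be positive.\<close>

lemma gle_gclassD:
  assumes U: "ultrafilter U" and le: "gle U (gclass U (hclass U x)) (gclass U (hclass U y))"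
  obtains C where "C > 0" "eventually (\<lambda>k. \<bar>x k\<bar> \<le> C * \<bar>y k\<bar>) U"
proof (cases "gless U (gclass U (hclass U x)) (gclass U (hclass U y))")
  case True
  then have "eventually (\<lambda>k. 1 * \<bar>x k\<bar> < \<bar>y k\<bar>) U"
    unfolding gless_gclass_iff[OF U] using zero_less_one by blast
  then have "eventually (\<lambda>k. \<bar>x k\<bar> \<le> 1 * \<bar>y k\<bar>) U" by eventually_elim simp
  then show ?thesis using that[of 1] by simp
next
  case False
  with le abs_in_gclass[OF U, of x] have "hclass U (\<lambda>k. \<bar>x k\<bar>) \<in> gclass U (hclass U y)"
    by (simp add: gle_def)
  then obtain b where "eventually (\<lambda>k. \<bar>x k\<bar> \<le> b * \<bar>y k\<bar>) U"
    using U by (auto simp: hclass_in_gclass_iff eventually_conj_iff)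
  then have "eventually (\<lambda>k. \<bar>x k\<bar> \<le> max 1 b * \<bar>y k\<bar>) U"
    by eventually_elim (meson abs_ge_zero max.cobounded2 mult_right_mono order_trans)
  then show ?thesis using that[of "max 1 b"] by simp
qed

section \<open>Infinitesimal classes and approximating integers in terms of sequences\<close>

lemma PP_epsE:
  assumes "\<mu> \<in> PP_eps U"
  obtains x where "\<mu> = gclass U (hclass U x)"
proof -
  from assms obtain X where "X \<in> hreals U" "\<mu> = gclass U X"
    unfolding PP_eps_def hinfinitesimal_def by blast
  then show ?thesis using that by (metis hrealsE)
qed

lemma gclass_in_PP_eps:
  assumes "ultrafilter U" "eventually (\<lambda>k. 0 < x k) U" "\<And>r. r > 0 \<Longrightarrow> eventually (\<lambda>k. \<bar>x k\<bar> < r) U"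
  shows "gclass U (hclass U x) \<in> PP_eps U"
proof -
  have "hclass U (\<lambda>k. \<bar>x k\<bar>) \<in> hnonneg U"
    using assms by (simp add: hclass_in_hnonneg_iff)
  then have "gclass U (hclass U x) \<in> PP U"
    by (auto simp: PP_def gclass_def habs_hclass intro: quotientI)
  moreover have "hclass U x \<in> hinfinitesimal U"
    using assms by (simp add: hclass_in_hinfinitesimal_iff)
  moreover have "hless U (hconst U 0) (hclass U x)" using assms by (simp add: hconst_def hless_hclass)
  ultimately show ?thesis by (auto simp: PP_eps_def)
qed

text \<open>\<open>perp\<close> is a definite description, so the point is uniqueness: two integers
  within 1/2 of the same real number differ by less than 1 and hence coincide.\<close>

lemma approx_error_hclass:
  fixes n m :: "nat \<Rightarrow> int" and \<theta> :: real
  assumes U: "ultrafilter U" and small: "\<And>r. r > 0 \<Longrightarrow> eventually (\<lambda>k. \<bar>n k * \<theta> - m k\<bar> < r) U"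
  shows "approx_error U \<theta> (hclass U (\<lambda>k. n k)) = hclass U (\<lambda>k. n k * \<theta> - m k)"
proof -
  have "perp U \<theta> (hclass U (\<lambda>k. n k)) = hclass U (\<lambda>k. m k)"
    unfolding perp_def
  proof (rule the_equality)
    show "hclass U (\<lambda>k. m k) \<in> hints U \<and>
        hminus U (htimes U (hclass U (\<lambda>k. n k)) (hconst U \<theta>)) (hclass U (\<lambda>k. m k)) \<in> hinfinitesimal U"
      using small by (auto simp: hints_def hconst_def htimes_hclass hminus_hclass
          hclass_in_hinfinitesimal_iff)
  next
    fix M assume M: "M \<in> hints U \<and>
        hminus U (htimes U (hclass U (\<lambda>k. n k)) (hconst U \<theta>)) M \<in> hinfinitesimal U"
    then obtain m' :: "nat \<Rightarrow> int" where m': "M = hclass U (\<lambda>k. m' k)" by (auto simp: hints_def)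
    with M have "\<forall>r>0. eventually (\<lambda>k. \<bar>n k * \<theta> - m' k\<bar> < r) U"
      by (simp add: hconst_def htimes_hclass hminus_hclass hclass_in_hinfinitesimal_iff)
    then have "eventually (\<lambda>k. \<bar>n k * \<theta> - m' k\<bar> < 1/2) U" by (rule allE[of _ "1/2"]) simp
    moreover have "eventually (\<lambda>k. \<bar>n k * \<theta> - m k\<bar> < 1/2) U" by (rule small) simp
    ultimately have "eventually (\<lambda>k. real_of_int (m' k) = m k) U"
    proof eventually_elim
      case (elim k)
      then have "\<bar>real_of_int (m' k - m k)\<bar> < 1" by linarith
      then have "m' k = m k" by linarith
      then show ?case by simp
    qed
    then show "M = hclass U (\<lambda>k. m k)" by (simp add: m' hclass_eq_iff)
  qed
  then show ?thesis by (simp add: approx_error_def hconst_def htimes_hclass hminus_hclass)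
qed

text \<open>From here on only integer sequences \<open>n\<close> and \<open>m\<close> are handled:
  \<open>hints\<close> supplies such representatives, and the approximation error becomes an
  explicit sequence.\<close>

lemma hints_growth_decay_nontrivial_iff:
  fixes \<theta> :: real
  assumes U: "ultrafilter U"
  shows "hints_growth_decay U \<mu> \<nu> \<theta> \<noteq> {hconst U 0} \<longleftrightarrow>
    (\<exists>(n :: nat \<Rightarrow> int) (m :: nat \<Rightarrow> int). eventually (\<lambda>k. n k \<noteq> (0 :: int)) U \<and>
      (\<forall>r>0. eventually (\<lambda>k. \<bar>n k * \<theta> - m k\<bar> < r) U) \<and>
      gless U \<mu> (gclass U (hclass U (\<lambda>k. inverse (n k)))) \<and>
      gle U (gclass U (hclass U (\<lambda>k. n k * \<theta> - m k))) \<nu>)" (is "?L \<longleftrightarrow> ?R")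
proof
  assume ?L
  then obtain N where N: "N \<in> hints_approx U \<theta>" "N \<noteq> hconst U 0" "gless U \<mu> (growth U N)"
      "gle U (decay U \<theta> N) \<nu>"
    by (auto simp: hints_growth_decay_def)
  then obtain n m :: "nat \<Rightarrow> int" where n: "N = hclass U (\<lambda>k. n k)"
    and m: "hminus U (htimes U N (hconst U \<theta>)) (hclass U (\<lambda>k. m k)) \<in> hinfinitesimal U"
    by (auto simp: hints_approx_def hints_def)
  have small: "\<forall>r>0. eventually (\<lambda>k. \<bar>n k * \<theta> - m k\<bar> < r) U"
    using m by (simp add: n hconst_def htimes_hclass hminus_hclass hclass_in_hinfinitesimal_iff)
  have "eventually (\<lambda>k. n k \<noteq> 0) U"
    using N(2) U by (simp add: n hconst_def hclass_eq_iff ultrafilter_eventually_not_iff)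
  with small N U show ?R
    by - (rule exI[of _ n], rule exI[of _ m],
        simp add: n growth_hclass decay_def approx_error_hclass[of U n \<theta> m])
next
  assume ?R
  then obtain n m :: "nat \<Rightarrow> int" where n: "eventually (\<lambda>k. n k \<noteq> 0) U"
    and small: "\<forall>r>0. eventually (\<lambda>k. \<bar>n k * \<theta> - m k\<bar> < r) U"
    and g: "gless U \<mu> (gclass U (hclass U (\<lambda>k. inverse (n k))))"
      "gle U (gclass U (hclass U (\<lambda>k. n k * \<theta> - m k))) \<nu>"
    by blast
  let ?N = "hclass U (\<lambda>k. real_of_int (n k))"
  have "?N \<noteq> hconst U 0"
    using n U by (simp add: hconst_def hclass_eq_iff ultrafilter_eventually_not_iff)
  moreover have "\<exists>M\<in>hints U. hminus U (htimes U ?N (hconst U \<theta>)) M \<in> hinfinitesimal U"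
    using small by (intro bexI[of _ "hclass U (\<lambda>k. m k)"])
      (auto simp: hints_def hconst_def htimes_hclass hminus_hclass hclass_in_hinfinitesimal_iff)
  then have "?N \<in> hints_approx U \<theta>" by (auto simp: hints_approx_def hints_def)
  ultimately have "?N \<in> hints_growth_decay U \<mu> \<nu> \<theta>"
    using small g U
    by (simp add: hints_growth_decay_def growth_hclass decay_def approx_error_hclass[of U n \<theta> m])
  with \<open>?N \<noteq> hconst U 0\<close> show ?L by blast
qed

section \<open>Badly approximable numbers and antiprime sets\<close>

lemma dist_nearest_int_le: "dist_nearest_int x \<le> \<bar>x - of_int m\<bar>"
  using round_diff_minimal[of x m] by (simp add: dist_nearest_int_def)

text \<open>The liminf bounds all large \<open>n\<close>; irrationality makes each of the finitely
  many other terms positive. Conversely, a uniform bound excludes a rational number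
  \<open>p / q\<close>, for which \<open>n = q\<close> and \<open>m = p\<close> give zero.\<close>

lemma badly_approximable_iff:
  fixes \<theta> :: real
  shows "\<theta> \<in> badly_approximable \<longleftrightarrow>
    (\<exists>c>0. \<forall>(n :: int) (m :: int). n \<noteq> 0 \<longrightarrow> c \<le> \<bar>real_of_int n\<bar> * \<bar>n * \<theta> - m\<bar>)" (is "?L \<longleftrightarrow> ?R")
proof
  assume L: ?L
  define f where "f n = real n * dist_nearest_int (real n * \<theta>)" for n :: nat
  from L have irr: "\<theta> \<notin> \<rat>" and "liminf (\<lambda>n. ereal (f n)) > 0"
    by (auto simp: badly_approximable_def f_def)
  then obtain y where y: "0 < y" "y < liminf (\<lambda>n. ereal (f n))"
    using dense by blast
  then have "eventually (\<lambda>n. y < ereal (f n)) sequentially" by (intro less_LiminfD)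
  then obtain N where N: "\<And>n. n \<ge> N \<Longrightarrow> y < ereal (f n)" by (auto simp: eventually_sequentially)
  \<comment> \<open>Positivity excludes minus infinity, and lying below the real number
    \<open>f N\<close> excludes plus infinity.\<close>
  then obtain b where b: "y = ereal b" using y(1) by (cases y) auto
  have pos: "f n > 0" if "n > 0" for n
  proof -
    have "real n * \<theta> \<noteq> of_int (round (real n * \<theta>))"
    proof
      assume "real n * \<theta> = of_int (round (real n * \<theta>))"
      then have "\<theta> = of_int (round (real n * \<theta>)) / real n" using that by (simp add: field_simps)
      then show False using irr by (metis Rats_divide Rats_of_int Rats_of_nat)
    qed
    then show ?thesis using that by (simp add: f_def dist_nearest_int_def)
  qed
  define c where "c = Min (insert b (f ` {1..<N}))"
  have c: "c > 0" using y(1) pos by (auto simp: c_def b)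
  have cf: "c \<le> f n" if "n > 0" for n
  proof (cases "n < N")
    case True
    with that have "f n \<in> insert b (f ` {1..<N})" by auto
    then show ?thesis unfolding c_def by (intro Min_le) auto
  next
    case False
    then have "b \<le> f n" using N[of n] b by simp
    moreover have "c \<le> b" by (auto simp: c_def)
    ultimately show ?thesis by simp
  qed
  have "c \<le> \<bar>real_of_int n\<bar> * \<bar>n * \<theta> - m\<bar>" if "n \<noteq> 0" for n m :: int
  proof -
    \<comment> \<open>Negative \<open>n\<close> reduce to natural numbers: multiplying both
      \<open>n\<close> and \<open>m\<close> by \<open>sgn n\<close> leaves the absolute error
      unchanged.\<close>
    have n: "real (nat \<bar>n\<bar>) = of_int (sgn n) * real_of_int n" "\<bar>real_of_int n\<bar> = real (nat \<bar>n\<bar>)"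
      by (auto simp: sgn_if)
    have "c \<le> f (nat \<bar>n\<bar>)" using that by (intro cf) simp
    also have "\<dots> \<le> real (nat \<bar>n\<bar>) * \<bar>real (nat \<bar>n\<bar>) * \<theta> - of_int (sgn n * m)\<bar>"
      unfolding f_def by (intro mult_left_mono dist_nearest_int_le) auto
    also have "real (nat \<bar>n\<bar>) * \<theta> - of_int (sgn n * m) = of_int (sgn n) * (n * \<theta> - m)"
      unfolding n by (simp add: algebra_simps)
    also have "\<bar>\<dots>\<bar> = \<bar>n * \<theta> - m\<bar>" using that by (simp add: abs_mult sgn_if)
    finally show ?thesis unfolding n(2) .
  qed
  with c show ?R by blast
next
  assume ?R
  then obtain c where c: "c > 0"
    and le: "\<And>(n :: int) (m :: int). n \<noteq> 0 \<Longrightarrow> c \<le> \<bar>real_of_int n\<bar> * \<bar>n * \<theta> - m\<bar>" by blast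
  have "\<theta> \<notin> \<rat>"
  proof
    assume "\<theta> \<in> \<rat>"
    then obtain p q :: int where "q > 0" "\<theta> = of_int p / of_int q"
      by (cases rule: Rats_cases') auto
    then show False using le[of q p] c by simp
  qed
  moreover have "eventually (\<lambda>n. ereal c \<le> ereal (real n * dist_nearest_int (real n * \<theta>))) sequentially"
    using eventually_gt_at_top[of 0]
  proof eventually_elim
    case (elim n)
    then show ?case using le[of "int n" "round (real n * \<theta>)"] by (simp add: dist_nearest_int_def)
  qed
  then have "ereal c \<le> liminf (\<lambda>n. ereal (real n * dist_nearest_int (real n * \<theta>)))"
    by (rule Liminf_bounded)
  then have "0 < liminf (\<lambda>n. ereal (real n * dist_nearest_int (real n * \<theta>)))"
    using c by (metis ereal_less(2) less_le_trans)
  ultimately show ?L by (simp add: badly_approximable_def)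
qed

lemma badly_approximable_not_composable:
  assumes U: "ultrafilter U" and \<theta>: "\<theta> \<in> badly_approximable"
  shows "\<not> composable U \<mu> \<nu> \<theta> \<eta>"
proof
  assume comp: "composable U \<mu> \<nu> \<theta> \<eta>"
  then obtain x y where x: "\<mu> = gclass U (hclass U x)" and y: "\<nu> = gclass U (hclass U y)"
    by (auto simp: composable_def elim!: PP_epsE)
  from comp obtain n m :: "nat \<Rightarrow> int" where n: "eventually (\<lambda>k. n k \<noteq> 0) U"
    and g: "gless U \<mu> (gclass U (hclass U (\<lambda>k. inverse (n k))))"
      "gle U (gclass U (hclass U (\<lambda>k. n k * \<theta> - m k))) \<nu>" and "gle U \<nu> \<mu>"
    unfolding composable_def hints_growth_decay_nontrivial_iff[OF U] by blast
  obtain A where A: "A > 0" "eventually (\<lambda>k. \<bar>n k * \<theta> - m k\<bar> \<le> A * \<bar>y k\<bar>) U"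
    using gle_gclassD[OF U] g(2) y by blast
  obtain B where B: "B > 0" "eventually (\<lambda>k. \<bar>y k\<bar> \<le> B * \<bar>x k\<bar>) U"
    using gle_gclassD[OF U] \<open>gle U \<nu> \<mu>\<close> x y by blast
  obtain c where c: "c > 0"
    and le: "\<And>(n :: int) (m :: int). n \<noteq> 0 \<Longrightarrow> c \<le> \<bar>real_of_int n\<bar> * \<bar>n * \<theta> - m\<bar>"
    using \<theta> unfolding badly_approximable_iff by blast
  \<comment> \<open>The constant is tuned to give
    \<open>\<bar>n k\<bar> * (A * B * \<bar>x k\<bar>) < c\<close>, where
    \<open>A * B * \<bar>x k\<bar>\<close> bounds the error of \<open>n k\<close>.\<close>
  have "eventually (\<lambda>k. A * B / c * \<bar>x k\<bar> < \<bar>inverse (real_of_int (n k))\<bar>) U"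
    by (rule g(1)[unfolded x gless_gclass_iff[OF U], rule_format]) (use A B c in simp)
  with A(2) B(2) n have "eventually (\<lambda>k. False) U"
  proof eventually_elim
    case (elim k)
    define N where "N = \<bar>real_of_int (n k)\<bar>"
    have N: "N > 0" using elim by (simp add: N_def)
    have "A * B / c * \<bar>x k\<bar> < inverse N" using elim by (simp add: N_def abs_inverse)
    then have "N * (A * B * \<bar>x k\<bar>) < c" using N c by (simp add: field_simps)
    moreover have "A * \<bar>y k\<bar> \<le> A * (B * \<bar>x k\<bar>)" using elim A by (intro mult_left_mono) auto
    then have "\<bar>n k * \<theta> - m k\<bar> \<le> A * B * \<bar>x k\<bar>" using elim by (simp add: mult.assoc)
    then have "N * \<bar>n k * \<theta> - m k\<bar> \<le> N * (A * B * \<bar>x k\<bar>)" using N by (intro mult_left_mono) auto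
    moreover have "c \<le> N * \<bar>n k * \<theta> - m k\<bar>" unfolding N_def using elim by (intro le) auto
    ultimately show False by linarith
  qed
  with U show False by (simp add: ultrafilter_def eventually_False)
qed

text \<open>Complements of singletons belong to a nonprincipal ultrafilter, hence so do their finite
  intersections, and ordinary limits carry over to \<open>U\<close>.\<close>

lemma nonprincipal_le_sequentially:
  assumes "ultrafilter U" "nonprincipal U"
  shows "U \<le> sequentially"
proof (rule filter_leI)
  fix P :: "nat \<Rightarrow> bool" assume "eventually P sequentially"
  then obtain K where K: "\<And>k. k \<ge> K \<Longrightarrow> P k" by (auto simp: eventually_sequentially)
  have "eventually (\<lambda>k. \<forall>j\<in>{..<K}. k \<noteq> j) U"
    using assms by (intro eventually_ball_finite)
      (auto simp: nonprincipal_def ultrafilter_eventually_not_iff)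
  then show "eventually P U" by eventually_elim (metis K lessThan_iff not_le)
qed

lemma not_badly_approximable_composable:
  assumes U: "ultrafilter U" "nonprincipal U" and \<theta>: "\<theta> \<notin> badly_approximable"
  shows "\<exists>\<mu>. composable U \<mu> \<mu> \<theta> \<theta>"
proof -
  \<comment> \<open>If this failed for one \<open>k\<close>, the right-hand side would be an
    admissible constant \<open>c\<close>. The square provides one vanishing factor for each of the
    two strict comparisons below.\<close>
  have "\<exists>(n :: int) (m :: int). n \<noteq> 0 \<and> \<bar>real_of_int n\<bar> * \<bar>n * \<theta> - m\<bar> < (1 / (real k + 1))\<^sup>2" for k
  proof (rule ccontr)
    assume "\<not> ?thesis"
    then have "\<theta> \<in> badly_approximable"
      unfolding badly_approximable_iff by (intro exI[of _ "(1 / (real k + 1))\<^sup>2"]) (force simp: not_less)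
    with \<theta> show False by blast
  qed
  then obtain n m :: "nat \<Rightarrow> int" where n: "\<And>k. n k \<noteq> 0"
    and lt: "\<And>k. \<bar>real_of_int (n k)\<bar> * \<bar>n k * \<theta> - m k\<bar> < (1 / (real k + 1))\<^sup>2" by metis
  define h where "h k = 1 / (real k + 1)" for k
  have h: "0 < h k" "h k \<le> 1" for k by (auto simp: h_def)
  have h_small: "eventually (\<lambda>k. h k < r) U" if "r > 0" for r
  proof -
    have "h \<longlonglongrightarrow> 0" unfolding h_def using LIMSEQ_inverse_real_of_nat
      by (simp add: inverse_eq_divide add.commute)
    then have "eventually (\<lambda>k. h k < r) sequentially" using that by (rule order_tendstoD)
    with nonprincipal_le_sequentially[OF U] show ?thesis by (rule filter_leD)
  qed
  \<comment> \<open>\<open>x\<close> is smaller than the growth \<open>1 / \<bar>n k\<bar>\<close>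
    by the factor \<open>h k\<close>, and the error is below \<open>x k\<close> by another factor
    \<open>h k\<close>.\<close>
  define x where "x k = h k / \<bar>real_of_int (n k)\<bar>" for k
  \<comment> \<open>Nonzero integers have absolute value at least 1, so \<open>x k \<le> h k\<close>
    and \<open>x\<close> is infinitesimal.\<close>
  have n1: "1 \<le> \<bar>real_of_int (n k)\<bar>" for k using n[of k] by linarith
  have x: "0 < x k" "x k \<le> h k" for k
    using h[of k] n[of k] n1[of k] by (auto simp: x_def divide_le_eq mult_left_le)
  have err: "\<bar>n k * \<theta> - m k\<bar> < h k * x k" for k
    using lt[of k] n[of k] unfolding x_def h_def[symmetric]
    by (simp add: power2_eq_square pos_less_divide_eq mult.commute)
  let ?\<mu> = "gclass U (hclass U x)"
  have "?\<mu> \<in> PP_eps U"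
  proof (rule gclass_in_PP_eps[OF U(1)])
    show "eventually (\<lambda>k. \<bar>x k\<bar> < r) U" if "r > 0" for r
      using h_small[OF that]
    proof eventually_elim
      case (elim k)
      then show ?case using x[of k] by linarith
    qed
  qed (simp add: x)
  moreover have "hints_growth_decay U ?\<mu> ?\<mu> \<theta> \<noteq> {hconst U 0}"
    unfolding hints_growth_decay_nontrivial_iff[OF U(1)]
  proof (rule exI[of _ n], rule exI[of _ m], intro conjI allI impI)
    show "eventually (\<lambda>k. n k \<noteq> 0) U" by (simp add: n)
  next
    fix r :: real assume "r > 0"
    from h_small[OF this] show "eventually (\<lambda>k. \<bar>n k * \<theta> - m k\<bar> < r) U"
    proof eventually_elim
      case (elim k)
      have "h k * x k \<le> 1 * h k" using h[of k] x[of k] by (intro mult_mono) auto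
      with elim err[of k] show ?case by linarith
    qed
  next
    show "gless U ?\<mu> (gclass U (hclass U (\<lambda>k. inverse (n k))))"
      unfolding gless_gclass_iff[OF U(1)]
    proof (intro allI impI)
      fix C :: real assume C: "C > 0"
      \<comment> \<open>The factor \<open>h k\<close> eventually beats any given constant
        \<open>C\<close>.\<close>
      then have "eventually (\<lambda>k. h k < 1 / C) U" by (intro h_small) simp
      then show "eventually (\<lambda>k. C * \<bar>x k\<bar> < \<bar>inverse (real_of_int (n k))\<bar>) U"
      proof eventually_elim
        case (elim k)
        then have "C * h k < 1" using C by (simp add: field_simps)
        then have "C * h k / \<bar>real_of_int (n k)\<bar> < 1 / \<bar>real_of_int (n k)\<bar>"
          using n[of k] by (intro divide_strict_right_mono) auto
        then show ?case using x(1)[of k] by (simp add: x_def[of k] abs_inverse inverse_eq_divide h less_imp_le)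
      qed
    qed
  next
    have "gless U (gclass U (hclass U (\<lambda>k. n k * \<theta> - m k))) ?\<mu>"
      unfolding gless_gclass_iff[OF U(1)]
    proof (intro allI impI)
      fix C :: real assume C: "C > 0"
      then have "eventually (\<lambda>k. h k < 1 / C) U" by (intro h_small) simp
      then show "eventually (\<lambda>k. C * \<bar>n k * \<theta> - m k\<bar> < \<bar>x k\<bar>) U"
      proof eventually_elim
        case (elim k)
        then have "C * h k < 1" using C by (simp add: field_simps)
        then have "C * h k * x k < 1 * x k" using x(1)[of k] by (rule mult_strict_right_mono)
        moreover have "C * \<bar>n k * \<theta> - m k\<bar> < C * (h k * x k)"
          using C err by (intro mult_strict_left_mono)
        ultimately show ?case using x(1)[of k] unfolding mult.assoc by linarith
      qed
    qed
    then show "gle U (gclass U (hclass U (\<lambda>k. n k * \<theta> - m k))) ?\<mu>" by (simp add: gle_def)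
  qed
  ultimately have "composable U ?\<mu> ?\<mu> \<theta> \<theta>" by (simp add: composable_def gle_def)
  then show ?thesis ..
qed

lemma antiprime_iff_subset_badly_approximable:
  assumes "ultrafilter U" "nonprincipal U"
  shows "antiprime U X \<longleftrightarrow> X \<subseteq> badly_approximable"
proof
  assume X: "antiprime U X"
  show "X \<subseteq> badly_approximable"
  proof
    fix \<theta> assume "\<theta> \<in> X"
    \<comment> \<open>The antiprime condition is applied to the pair consisting of
      \<open>\<theta>\<close> twice.\<close>
    with X have "\<nexists>\<mu>. composable U \<mu> \<mu> \<theta> \<theta>"
      by (auto simp: antiprime_def antidivisor_def flat_divisor_def)
    with assms show "\<theta> \<in> badly_approximable" using not_badly_approximable_composable by blast
  qed
next
  assume "X \<subseteq> badly_approximable"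
  with assms(1) have "\<not> composable U \<mu> \<nu> \<theta> \<eta>" if "\<theta> \<in> X" for \<mu> \<nu> \<theta> \<eta>
    using that badly_approximable_not_composable by blast
  then show "antiprime U X"
    by (simp add: antiprime_def antidivisor_def fast_divisor_def slow_divisor_def
        flat_divisor_def mult.commute)
qed

theorem proposition16:
  fixes U :: "nat filter"
  assumes "ultrafilter U" and "nonprincipal U"
  shows "maximal_antiprime U badly_approximable \<and>
         (\<forall>X. maximal_antiprime U X \<longrightarrow> X = badly_approximable)"
  \<comment> \<open>Among the subsets of a fixed set, that set is the only maximal one.\<close>
  unfolding maximal_antiprime_def antiprime_iff_subset_badly_approximable[OF assms] by blast

end
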